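(* Let $n\ge 1$, fix $\alpha>0$, and let $\boldsymbol\gamma=[\gamma_{\{p,q\}}]_{\{p,q\}\in B}$ be a conductivity profile. Let $m\ge 3n$ and let $\mathbf d(k)=(\overline{\mathbf u}(k),\overline{\mathbf v}(k))$, $k=1,\dots,m$, be Cauchy data pairs for $\boldsymbol\gamma$, such that $\{\overline{\mathbf u}(k)\}_{k=1}^m$ contains a basis of the subspace of $\mathbb R^{4n}$ generated by the last $3n$ coordinates. Consider the network with input data $\widetilde{\mathbf x}^{(1)}(k)=\overline{\mathbf u}(k)$ and $\widehat{\mathbf x}^{(1)}(k)=\overline{\mathbf v}(k)$, $k=1,\dots,m$, and its loss $C_\alpha$. Then there are minima $\widetilde W_*$ of $C_\alpha$ with $C_\alpha(\widetilde W_* )=0$. Moreover, for every $\widetilde W$ with $C_\alpha(\widetilde W)=0$, the second-layer coefficient matrix $M=(M_{rp})_{r,p\in\overline D}$ of the network satisfies $$ M_{rp}=\begin{cases} \gamma_{\{p,r\}}, & \{p,r\}\in B,\ r\in D,\\ -\gamma_{\{p,r\}}, & \{p,r\}\in B,\ r\in\partial D,\\ 0, & \{p,r\}\notin B,\ p\neq r,\\ -\sum_{q\in\mathcal N(r)}\gamma_{\{q,r\}}, & p=r\in D,\\ \gamma_{\{q,r\}}, & p=r\in\partial D,\ \{q\}=\mathcal N(r). \end{cases} $$ (Equivalently, the trainable edge weights satisfy $\widetilde w^{(2)}_{\{p,r\}}=\gamma_{\{p,r\}}$ for all $\{p,r\}\in B$.)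
   Context: Lattice. $D=\{(i,j): i,j=1,\dots,n\}$; $\partial D$ consists of the $4n$ points $(0,j),(n+1,j)$ for $1\le j\le n$ and $(i,0),(i,n+1)$ for $1\le i\le n$; $\overline D=D\cup\partial D$. $B$ is the set of edges $\{p,q\}$ with $p=(i,j),q=(i',j')\in\overline D$, $|i-i'|+|j-j'|=1$, and at least one of $p,q$ in $D$ (so $|B|=2n(n+1)$). $\mathcal N(p)$ is the set of $q$ with $\{p,q\}\in B$; it has four elements if $p\in D$ and exactly one element (in $D$) if $p\in\partial D$. Boundary ordering. Identify $\mathbb R^{\partial D}$ with $\mathbb R^{4n}$ by listing the boundary points as $q^{(k)}=(k,n+1)$ for $1\le k\le n$; $q^{(k)}=(n+1,\,n+1-(k-n))$ for $n+1\le k\le 2n$; $q^{(k)}=(n+1-(k-2n),\,0)$ for $2n+1\le k\le 3n$; $q^{(k)}=(0,\,k-3n)$ for $3n+1\le k\le 4n$. The subspace generated by the last $3n$ coordinates consists of the vectors whose first $n$ coordinates vanish. Conductivity problem. A conductivity profile assigns a number $\gamma_{\{p,q\}}>0$ to each edge in $B$. For $\overline{\mathbf u}\in\mathbb R^{\partial D}$ there is a unique $\mathbf u=[u_p]_{p\in\overline D}$ with $\sum_{q\in\mathcal N(p)}\gamma_{\{q,p\}}(u_q-u_p)=0$ for $p\in D$ and $u_q=\overline u_q$ for $q\in\partial D$. A Cauchy data pair for $\boldsymbol\gamma$ is $(\overline{\mathbf u},\overline{\mathbf v})$ with $\overline v_q=\gamma_{\{q,p\}}(u_q-u_p)$ for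 $q\in\partial D$, $\mathcal N(q)=\{p\}$. Network. The trainable parameters are $\widetilde W=(\widetilde W^{(1)},\widetilde W^{(2)})$: $\widetilde W^{(1)}$ consists of arbitrary real weights $\widetilde w^{(1)}_{qp}$, $q\in\partial D$, $p\in D$; $\widetilde W^{(2)}$ consists of arbitrary real (symmetric) edge weights $\widetilde w^{(2)}_{\{p,r\}}=\widetilde w^{(2)}_{pr}=\widetilde w^{(2)}_{rp}$, $\{p,r\}\in B$. Given inputs $\widetilde{\mathbf x}^{(1)},\widehat{\mathbf x}^{(1)}\in\mathbb R^{\partial D}$, the hidden layer is $\widetilde x^{(2)}_q=\widetilde x^{(1)}_q$ for $q\in\partial D$, $\widetilde x^{(2)}_p=\sum_{q\in\partial D}\widetilde w^{(1)}_{qp}\widetilde x^{(1)}_q$ for $p\in D$, and $\widehat x^{(2)}_q=\widehat x^{(1)}_q$ for $q\in\partial D$. The output $\mathbf y\in\mathbb R^{\overline D}$ is $$y_r=\sum_{p\in\mathcal N(r)}\widetilde w^{(2)}_{pr}(\widetilde x^{(2)}_p-\widetilde x^{(2)}_r)\ (r\in D),\qquad y_r=\widetilde w^{(2)}_{pr}(\widetilde x^{(2)}_r-\widetilde x^{(2)}_p)-\widehat x^{(2)}_r\ (r\in\partial D,\ \mathcal N(r)=\{p\}).$$ The second-layer coefficient matrix $M$ is the matrix for which $y_r=\sum_{p\in\overline D}M_{rp}\widetilde x^{(2)}_p$ for $r\in D$ and $y_r=\sum_{p\in\overline D}M_{rp}\widetilde x^{(2)}_p-\widehat x^{(2)}_r$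 for $r\in\partial D$; that is, $M_{rp}=\widetilde w^{(2)}_{\{p,r\}}$ if $r\in D$, $\{p,r\}\in B$; $M_{rr}=-\sum_{p\in\mathcal N(r)}\widetilde w^{(2)}_{pr}$ if $r\in D$; $M_{rp}=-\widetilde w^{(2)}_{\{p,r\}}$ and $M_{rr}=\widetilde w^{(2)}_{\{p,r\}}$ if $r\in\partial D$, $\mathcal N(r)=\{p\}$; and all other entries are $0$. Loss. With $\mathbf y(k)$ the output for the $k$-th input pair, $$C_\alpha(\widetilde W)=\frac1{2m}\sum_{k=1}^m\Big(\sum_{p\in\partial D}y_p(k)^2+\alpha\sum_{p\in D}y_p(k)^2\Big).$$ A minimum is a global minimizer of $C_\alpha$ over all trainable parameters $\widetilde W$. *)

theory Defs
  imports Complex_Main "Jordan_Normal_Form.VS_Connect"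
begin

section \<open>The lattice\<close>

type_synonym point = "int \<times> int"

definition interior_pts :: "nat \<Rightarrow> point set" where
  "interior_pts n = {1..int n} \<times> {1..int n}"

definition boundary_pts :: "nat \<Rightarrow> point set" where
  "boundary_pts n = {0, int n + 1} \<times> {1..int n} \<union> {1..int n} \<times> {0, int n + 1}"

definition lattice_pts :: "nat \<Rightarrow> point set" where
  "lattice_pts n = interior_pts n \<union> boundary_pts n"

definition edges :: "nat \<Rightarrow> point set set" where
  "edges n = {{p, q} | p q. p \<in> lattice_pts n \<and> q \<in> lattice_pts n
     \<and> \<bar>fst p - fst q\<bar> + \<bar>snd p - snd q\<bar> = 1
     \<and> (p \<in> interior_pts n \<or> q \<in> interior_pts n)}"

definition nbrs :: "nat \<Rightarrow> point \<Rightarrow> point set" where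
  "nbrs n p = {q. {p, q} \<in> edges n}"

text \<open>Only meaningful for boundary points, whose neighbour set is a singleton
  (lemma \<open>nbrs_boundary\<close>).\<close>

definition inner_nbr :: "nat \<Rightarrow> point \<Rightarrow> point" where
  "inner_nbr n q = the_elem (nbrs n q)"

section \<open>Boundary data as vectors of length \<open>4 * n\<close>\<close>

text \<open>The enumeration runs over \<open>1 \<le> k \<le> 4 * n\<close>, clockwise from the top-left corner:
  top, right (downwards), bottom (leftwards), left (upwards).\<close>

definition bdry_pt :: "nat \<Rightarrow> nat \<Rightarrow> point" where
  "bdry_pt n k =
    (if k \<le> n then (int k, int n + 1)
     else if k \<le> 2 * n then (int n + 1, int n + 1 - (int k - int n))
     else if k \<le> 3 * n then (int n + 1 - (int k - 2 * int n), 0)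
     else (0, int k - 3 * int n))"

text \<open>Entries of a \<open>vec\<close> are indexed from \<open>0\<close>.\<close>

definition bdry_vec :: "nat \<Rightarrow> (point \<Rightarrow> real) \<Rightarrow> real vec" where
  "bdry_vec n u = vec (4 * n) (\<lambda>k. u (bdry_pt n (k + 1)))"

definition last_coords :: "nat \<Rightarrow> real vec set" where
  "last_coords n = {v \<in> carrier_vec (4 * n). \<forall>k<n. v $ k = 0}"

definition is_basis_of_last_coords :: "nat \<Rightarrow> real vec set \<Rightarrow> bool" where
  "is_basis_of_last_coords n S \<longleftrightarrow>
     vectorspace.basis class_ring ((module_vec TYPE(real) (4 * n))\<lparr>carrier := last_coords n\<rparr>) S"

section \<open>The conductivity problem\<close>

definition conductivity_profile :: "nat \<Rightarrow> (point set \<Rightarrow> real) \<Rightarrow> bool" where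
  "conductivity_profile n \<gamma> \<longleftrightarrow> (\<forall>e\<in>edges n. \<gamma> e > 0)"

definition potential :: "nat \<Rightarrow> (point set \<Rightarrow> real) \<Rightarrow> (point \<Rightarrow> real) \<Rightarrow> (point \<Rightarrow> real) \<Rightarrow> bool" where
  "potential n \<gamma> ub u \<longleftrightarrow>
     (\<forall>p\<in>interior_pts n. (\<Sum>q\<in>nbrs n p. \<gamma> {q, p} * (u q - u p)) = 0) \<and>
     (\<forall>q\<in>boundary_pts n. u q = ub q)"

text \<open>The potential \<open>u\<close> is uniquely determined on \<open>lattice_pts n\<close> by \<open>ub\<close> when \<open>\<gamma>\<close> is positive,
  so the existential quantifier merely names it.\<close>

definition cauchy_pair :: "nat \<Rightarrow> (point set \<Rightarrow> real) \<Rightarrow> (point \<Rightarrow> real) \<Rightarrow> (point \<Rightarrow> real) \<Rightarrow> bool" where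
  "cauchy_pair n \<gamma> ub vb \<longleftrightarrow>
     (\<exists>u. potential n \<gamma> ub u \<and>
       (\<forall>q\<in>boundary_pts n. vb q = \<gamma> {q, inner_nbr n q} * (u q - u (inner_nbr n q))))"

section \<open>The network\<close>

text \<open>A parameter \<open>W\<close> consists of the first-layer weights \<open>fst W q p\<close>, with \<open>q\<close> on the boundary and
  \<open>p\<close> in the interior, and the second-layer weights \<open>snd W e\<close> on the edges \<open>e\<close>. Indexing by unordered
  edges makes the latter symmetric. Values at other arguments are never used.\<close>

type_synonym params = "(point \<Rightarrow> point \<Rightarrow> real) \<times> (point set \<Rightarrow> real)"

definition hidden :: "nat \<Rightarrow> params \<Rightarrow> (point \<Rightarrow> real) \<Rightarrow> point \<Rightarrow> real" where
  "hidden n W xt p =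
     (if p \<in> boundary_pts n then xt p else \<Sum>q\<in>boundary_pts n. fst W q p * xt q)"

definition net_output :: "nat \<Rightarrow> params \<Rightarrow> (point \<Rightarrow> real) \<Rightarrow> (point \<Rightarrow> real) \<Rightarrow> point \<Rightarrow> real" where
  "net_output n W xt xh r =
     (if r \<in> interior_pts n
      then \<Sum>p\<in>nbrs n r. snd W {p, r} * (hidden n W xt p - hidden n W xt r)
      else snd W {inner_nbr n r, r} * (hidden n W xt r - hidden n W xt (inner_nbr n r)) - xh r)"

definition coeff_matrix :: "nat \<Rightarrow> params \<Rightarrow> point \<Rightarrow> point \<Rightarrow> real" where
  "coeff_matrix n W r p =
     (if {p, r} \<in> edges n then (if r \<in> interior_pts n then snd W {p, r} else - snd W {p, r})
      else if p \<noteq> r then 0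
      else if r \<in> interior_pts n then - (\<Sum>q\<in>nbrs n r. snd W {q, r})
      else snd W {inner_nbr n r, r})"

definition loss ::
  "nat \<Rightarrow> real \<Rightarrow> nat \<Rightarrow> (nat \<Rightarrow> point \<Rightarrow> real) \<Rightarrow> (nat \<Rightarrow> point \<Rightarrow> real) \<Rightarrow> params \<Rightarrow> real" where
  "loss n \<alpha> m xt xh W = 1 / (2 * real m) * (\<Sum>k = 1..m.
     (\<Sum>p\<in>boundary_pts n. (net_output n W (xt k) (xh k) p)\<^sup>2)
     + \<alpha> * (\<Sum>p\<in>interior_pts n. (net_output n W (xt k) (xh k) p)\<^sup>2))"

definition global_minimizer :: "(params \<Rightarrow> real) \<Rightarrow> params \<Rightarrow> bool" where
  "global_minimizer C W \<longleftrightarrow> (\<forall>W'. C W \<le> C W')"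

section \<open>Consistency of the definitions\<close>

lemma edge_iff:
  "{p, q} \<in> edges n \<longleftrightarrow> p \<in> lattice_pts n \<and> q \<in> lattice_pts n
     \<and> \<bar>fst p - fst q\<bar> + \<bar>snd p - snd q\<bar> = 1
     \<and> (p \<in> interior_pts n \<or> q \<in> interior_pts n)"
proof -
  define R where "R = (\<lambda>p q :: point. p \<in> lattice_pts n \<and> q \<in> lattice_pts n
     \<and> \<bar>fst p - fst q\<bar> + \<bar>snd p - snd q\<bar> = 1
     \<and> (p \<in> interior_pts n \<or> q \<in> interior_pts n))"
  have sym: "R a b \<longleftrightarrow> R b a" for a b
    unfolding R_def by (simp add: abs_minus_commute conj_ac disj_commute)
  have "edges n = {{p, q} | p q. R p q}" by (simp only: edges_def R_def)
  then have "{p, q} \<in> edges n \<longleftrightarrow> (\<exists>a b. {p, q} = {a, b} \<and> R a b)" by simp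
  also have "\<dots> \<longleftrightarrow> R p q" using sym by (metis doubleton_eq_iff)
  finally show ?thesis by (simp only: R_def)
qed

lemma finite_lattice: "finite (lattice_pts n)"
  by (simp add: lattice_pts_def interior_pts_def boundary_pts_def)

lemma disjoint_boundary_interior: "boundary_pts n \<inter> interior_pts n = {}"
  by (auto simp: interior_pts_def boundary_pts_def)

lemma nbrs_subset: "nbrs n p \<subseteq> lattice_pts n - {p}"
  by (auto simp: nbrs_def edge_iff)

lemma nbrs_boundary:
  assumes "q \<in> boundary_pts n"
  shows "nbrs n q = {inner_nbr n q}" and "inner_nbr n q \<in> interior_pts n"
proof -
  have "\<exists>p\<in>interior_pts n. nbrs n q = {p}"
  proof -
    obtain i j where q: "q = (i, j)" by (cases q)
    have "q \<notin> interior_pts n" "q \<in> lattice_pts n"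
      using assms disjoint_boundary_interior by (auto simp: lattice_pts_def)
    then have nb: "(x, y) \<in> nbrs n q \<longleftrightarrow>
        1 \<le> x \<and> x \<le> int n \<and> 1 \<le> y \<and> y \<le> int n \<and> \<bar>i - x\<bar> + \<bar>j - y\<bar> = 1" for x y
      by (simp add: nbrs_def edge_iff q) (auto simp: lattice_pts_def interior_pts_def)
    consider "i = 0" "1 \<le> j" "j \<le> int n" | "i = int n + 1" "1 \<le> j" "j \<le> int n"
      | "j = 0" "1 \<le> i" "i \<le> int n" | "j = int n + 1" "1 \<le> i" "i \<le> int n"
      using assms unfolding q boundary_pts_def by auto
    then show ?thesis
    proof cases
      case 1
      then have "(x, y) \<in> nbrs n q \<longleftrightarrow> (x, y) = (1, j)" for x y
        unfolding nb by simp arith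
      then have "nbrs n q = {(1, j)}" by auto
      moreover have "(1, j) \<in> interior_pts n" using 1 by (simp add: interior_pts_def)
      ultimately show ?thesis by blast
    next
      case 2
      then have "(x, y) \<in> nbrs n q \<longleftrightarrow> (x, y) = (int n, j)" for x y
        unfolding nb by simp arith
      then have "nbrs n q = {(int n, j)}" by auto
      moreover have "(int n, j) \<in> interior_pts n" using 2 by (simp add: interior_pts_def)
      ultimately show ?thesis by blast
    next
      case 3
      then have "(x, y) \<in> nbrs n q \<longleftrightarrow> (x, y) = (i, 1)" for x y
        unfolding nb by simp arith
      then have "nbrs n q = {(i, 1)}" by auto
      moreover have "(i, 1) \<in> interior_pts n" using 3 by (simp add: interior_pts_def)
      ultimately show ?thesis by blast
    next
      case 4
      then have "(x, y) \<in> nbrs n q \<longleftrightarrow> (x, y) = (i, int n)" for x y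
        unfolding nb by simp arith
      then have "nbrs n q = {(i, int n)}" by auto
      moreover have "(i, int n) \<in> interior_pts n" using 4 by (simp add: interior_pts_def)
      ultimately show ?thesis by blast
    qed
  qed
  then obtain p where p: "p \<in> interior_pts n" "nbrs n q = {p}" by blast
  then have "inner_nbr n q = p" by (simp add: inner_nbr_def)
  with p show "nbrs n q = {inner_nbr n q}" "inner_nbr n q \<in> interior_pts n" by simp_all
qed

lemma net_output_eq_coeff_matrix:
  assumes r: "r \<in> lattice_pts n"
  shows "net_output n W xt xh r =
    (\<Sum>p\<in>lattice_pts n. coeff_matrix n W r p * hidden n W xt p)
    - (if r \<in> boundary_pts n then xh r else 0)"
proof -
  let ?h = "hidden n W xt" and ?M = "coeff_matrix n W r"
  have self: "{r} \<notin> edges n" using edge_iff[of r r n] by simp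
  have nb: "p \<in> nbrs n r \<longleftrightarrow> {p, r} \<in> edges n" for p
    by (simp add: nbrs_def insert_commute)
  have "(\<Sum>p\<in>lattice_pts n. ?M p * ?h p) = ?M r * ?h r + (\<Sum>p\<in>lattice_pts n - {r}. ?M p * ?h p)"
    using r finite_lattice by (simp add: sum.remove)
  also have "(\<Sum>p\<in>lattice_pts n - {r}. ?M p * ?h p) = (\<Sum>p\<in>nbrs n r. ?M p * ?h p)"
    using nbrs_subset[of n r]
    by (intro sum.mono_neutral_right) (auto simp: finite_lattice coeff_matrix_def nb)
  finally have S: "(\<Sum>p\<in>lattice_pts n. ?M p * ?h p) = ?M r * ?h r + (\<Sum>p\<in>nbrs n r. ?M p * ?h p)" .
  show ?thesis
  proof (cases "r \<in> interior_pts n")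
    case True
    then have nbd: "r \<notin> boundary_pts n" using disjoint_boundary_interior by blast
    have "(\<Sum>p\<in>nbrs n r. ?M p * ?h p) = (\<Sum>p\<in>nbrs n r. snd W {p, r} * ?h p)"
      using True by (intro sum.cong) (auto simp: coeff_matrix_def nb)
    moreover have "?M r = - (\<Sum>q\<in>nbrs n r. snd W {q, r})"
      using True self by (simp add: coeff_matrix_def)
    ultimately show ?thesis using True nbd S
      by (simp add: net_output_def right_diff_distrib sum_subtractf sum_distrib_right)
  next
    case False
    then have bd: "r \<in> boundary_pts n" using r by (simp add: lattice_pts_def)
    note N = nbrs_boundary(1)[OF bd]
    have e: "{inner_nbr n r, r} \<in> edges n" using N nb by blast
    have "?M (inner_nbr n r) = - snd W {inner_nbr n r, r}" "?M r = snd W {inner_nbr n r, r}"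
      using False self e by (simp_all add: coeff_matrix_def)
    then show ?thesis using False bd S by (simp add: net_output_def N algebra_simps)
  qed
qed

lemma bdry_pt_bij: "bij_betw (bdry_pt n) {1..4 * n} (boundary_pts n)"
proof -
  define g :: "point \<Rightarrow> nat" where "g = (\<lambda>(i, j).
    if j = int n + 1 then nat i else if i = int n + 1 then nat (2 * int n + 1 - j)
    else if j = 0 then nat (3 * int n + 1 - i) else nat (3 * int n + j))"
  have 1: "bdry_pt n k \<in> boundary_pts n \<and> g (bdry_pt n k) = k" if "k \<in> {1..4 * n}" for k
    using that by (simp add: g_def bdry_pt_def boundary_pts_def)
  have 2: "g q \<in> {1..4 * n} \<and> bdry_pt n (g q) = q" if q: "q \<in> boundary_pts n" for q
  proof -
    obtain i j where ij: "q = (i, j)" by (cases q)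
    consider "j = int n + 1" "1 \<le> i" "i \<le> int n" | "i = int n + 1" "1 \<le> j" "j \<le> int n"
      | "j = 0" "1 \<le> i" "i \<le> int n" | "i = 0" "1 \<le> j" "j \<le> int n"
      using q unfolding ij boundary_pts_def by auto
    then show ?thesis
      by cases (simp_all add: ij g_def bdry_pt_def nat_le_iff)
  qed
  show ?thesis using 1 2 by (intro bij_betwI[where g = g]) auto
qed

lemma vectorspace_last_coords:
  "vectorspace class_ring ((module_vec TYPE(real) (4 * n))\<lparr>carrier := last_coords n\<rparr>)"
proof -
  interpret vec_space "TYPE(real)" "4 * n" .
  have "subspace class_ring (last_coords n) V"
    by unfold_locales (auto simp: last_coords_def module_vec_simps)
  then show ?thesis by (rule subspace_is_vs)
qed

end

theory Submission
  imports Defs "Jordan_Normal_Form.Determinant"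
begin

text \<open>
  A parameter with zero loss exists because the Dirichlet problem for \<open>\<gamma>\<close> is uniquely solvable: take
  the true conductivities as edge weights and the solutions for unit boundary data as first-layer
  weights, so that the hidden layer is the true potential.

  The substance is the converse. For fixed weights the output is linear in the inputs, so a network with
  zero output on the data has zero output on all their linear combinations. These include the Cauchy data of every
  \<open>\<gamma>\<close>-harmonic \<open>u\<close> that vanishes on the top side (\<open>admissible\<close>), hence for each such \<open>u\<close> there is a
  function \<open>x\<close> on the lattice with the same boundary values as \<open>u\<close> and with the same net current at every
  lattice point, computed with the trained weights \<open>w\<close> for \<open>x\<close> and with \<open>\<gamma>\<close> for \<open>u\<close> (\<open>matched\<close>,
  \<open>zero_loss_imp_matched\<close>). The claim is that this forces \<open>w = \<gamma>\<close>, although nothing is known about the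
  signs of \<open>w\<close>, and although \<open>w\<close> may vanish a priori.

  The lattice is swept along the diagonals \<open>i - j = c\<close>, from the top left corner to the bottom right one.
  Once \<open>w = \<gamma>\<close> on all edges up to the diagonal \<open>c\<close> and \<open>x = u\<close> on all points up to it (\<open>agree c\<close>), the
  net current at a point of diagonal \<open>c\<close> gives an equation that involves only its right and its
  lower edge, which lead to the diagonal \<open>c + 1\<close> (\<open>forward_current_eq\<close>). These equations can be exploited one at a
  time because the test functions are as rich as possible: the values of an admissible \<open>u\<close> on two
  consecutive diagonals are arbitrary, apart from the zero on the top side
  (\<open>harmonic_with_diagonal_data\<close>). The equations of one diagonal are used twice. Running from
  the top right end, they show that \<open>x\<close> at a point of diagonal \<open>c + 1\<close> depends only on the values of \<open>u\<close> on
  the two diagonals at that point and to the right of it (\<open>zero_from_top_right\<close>). Running from the bottom left end, where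
  the unknown \<open>x\<close> at the lower neighbour is always settled already, they are tested with functions that
  are \<open>1\<close> at a single point of the two diagonals; the unknown \<open>x\<close> at the right neighbour then drops
  out, and the two weights can be read off (\<open>agree_on_diagonal\<close>).
\<close>

section \<open>The lattice in coordinates\<close>

lemma interior_iff: "(i, j) \<in> interior_pts n \<longleftrightarrow> 1 \<le> i \<and> i \<le> int n \<and> 1 \<le> j \<and> j \<le> int n"
  by (auto simp: interior_pts_def)

lemma lattice_iff:
  "(i, j) \<in> lattice_pts n \<longleftrightarrow>
     0 \<le> i \<and> i \<le> int n + 1 \<and> 0 \<le> j \<and> j \<le> int n + 1
     \<and> (1 \<le> i \<and> i \<le> int n \<or> 1 \<le> j \<and> j \<le> int n)"
  by (auto simp: lattice_pts_def interior_pts_def boundary_pts_def)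

lemma lattice_cases:
  "p \<in> lattice_pts n \<longleftrightarrow> p \<in> interior_pts n \<or> p \<in> boundary_pts n"
  by (simp add: lattice_pts_def)

lemma horizontal_edge_iff:
  assumes "i' = i + 1"
  shows "{(i, j), (i', j)} \<in> edges n \<longleftrightarrow> 0 \<le> i \<and> i \<le> int n \<and> 1 \<le> j \<and> j \<le> int n"
  unfolding edge_iff lattice_iff interior_iff assms by auto

lemma vertical_edge_iff:
  assumes "j' = j - 1"
  shows "{(i, j), (i, j')} \<in> edges n \<longleftrightarrow> 1 \<le> i \<and> i \<le> int n \<and> 1 \<le> j \<and> j \<le> int n + 1"
  unfolding edge_iff lattice_iff interior_iff assms by auto

text \<open>Weights of the edges to the right of and below a point. The value \<open>0\<close> for a missing edge lets the
  formulas below hold at all points, with no distinction between the interior, the four sides and the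
  outside.\<close>

definition hor :: "nat \<Rightarrow> (point set \<Rightarrow> real) \<Rightarrow> int \<Rightarrow> int \<Rightarrow> real" where
  "hor n g i j = (if {(i, j), (i + 1, j)} \<in> edges n then g {(i, j), (i + 1, j)} else 0)"

definition ver :: "nat \<Rightarrow> (point set \<Rightarrow> real) \<Rightarrow> int \<Rightarrow> int \<Rightarrow> real" where
  "ver n g i j = (if {(i, j), (i, j - 1)} \<in> edges n then g {(i, j), (i, j - 1)} else 0)"

lemma edge_cases:
  assumes "e \<in> edges n"
  obtains i j where "e = {(i, j), (i + 1, j)}" | i j where "e = {(i, j), (i, j - 1)}"
proof -
  obtain a b c d where e: "e = {(a, b), (c, d)}" and "\<bar>a - c\<bar> + \<bar>b - d\<bar> = 1"
    using assms by (auto simp: edges_def)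
  then consider "c = a + 1" "d = b" | "a = c + 1" "d = b" | "c = a" "d = b - 1" | "c = a" "b = d - 1"
    by linarith
  then show ?thesis
    by cases (use e that in \<open>auto simp: insert_commute\<close>)
qed

lemma weights_eq_if_hor_ver_eq:
  assumes "\<And>i j. hor n w i j = hor n \<gamma> i j" and "\<And>i j. ver n w i j = ver n \<gamma> i j"
    and "e \<in> edges n"
  shows "w e = \<gamma> e"
  using assms(3)
proof (cases rule: edge_cases)
  case (1 i j)
  then show ?thesis using assms(1)[of i j] assms(3) by (simp add: hor_def)
next
  case (2 i j)
  then show ?thesis using assms(2)[of i j] assms(3) by (simp add: ver_def)
qed

text \<open>At an interior point this is the weighted Laplacian; at a boundary point it is minus the flux in
  a Cauchy data pair. Treating both as one quantity makes "harmonic with the same flux" a single condition.\<close>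

definition net_current :: "nat \<Rightarrow> (point set \<Rightarrow> real) \<Rightarrow> (point \<Rightarrow> real) \<Rightarrow> point \<Rightarrow> real" where
  "net_current n g x p = (\<Sum>q\<in>nbrs n p. g {q, p} * (x q - x p))"

lemma net_current_coord:
  "net_current n g x (i, j) =
     hor n g (i - 1) j * (x (i - 1, j) - x (i, j)) + hor n g i j * (x (i + 1, j) - x (i, j))
     + ver n g i (j + 1) * (x (i, j + 1) - x (i, j)) + ver n g i j * (x (i, j - 1) - x (i, j))"
proof -
  let ?p = "(i, j)"
  let ?N = "{(i - 1, j), (i + 1, j), (i, j + 1), (i, j - 1)}"
  let ?t = "\<lambda>q. if {q, ?p} \<in> edges n then g {q, ?p} * (x q - x ?p) else 0"
  have sub: "nbrs n ?p \<subseteq> ?N"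
    by (auto simp: nbrs_def edge_iff)
  have "net_current n g x ?p = (\<Sum>q\<in>nbrs n ?p. ?t q)"
    unfolding net_current_def by (intro sum.cong) (auto simp: nbrs_def insert_commute)
  also have "\<dots> = (\<Sum>q\<in>?N. ?t q)"
    using sub by (intro sum.mono_neutral_left) (auto simp: nbrs_def insert_commute)
  also have "\<dots> = ?t (i - 1, j) + ?t (i + 1, j) + ?t (i, j + 1) + ?t (i, j - 1)"
    by simp
  finally show ?thesis
    by (simp add: hor_def ver_def insert_commute)
qed

lemma net_current_boundary:
  assumes "q \<in> boundary_pts n"
  shows "net_current n g x q = g {inner_nbr n q, q} * (x (inner_nbr n q) - x q)"
  unfolding net_current_def nbrs_boundary(1)[OF assms] by simp

lemma net_current_lincomb:
  "net_current n g (\<lambda>p. \<Sum>k\<in>K. c k * x k p) p = (\<Sum>k\<in>K. c k * net_current n g (x k) p)"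
proof -
  have "net_current n g (\<lambda>p. \<Sum>k\<in>K. c k * x k p) p
      = (\<Sum>q\<in>nbrs n p. \<Sum>k\<in>K. c k * (g {q, p} * (x k q - x k p)))"
    unfolding net_current_def
    by (simp add: sum_distrib_left sum_subtractf algebra_simps)
  also have "\<dots> = (\<Sum>k\<in>K. c k * net_current n g (x k) p)"
    unfolding net_current_def by (subst sum.swap) (simp add: sum_distrib_left)
  finally show ?thesis .
qed

definition harmonic :: "nat \<Rightarrow> (point set \<Rightarrow> real) \<Rightarrow> (point \<Rightarrow> real) \<Rightarrow> bool" where
  "harmonic n g u \<longleftrightarrow> (\<forall>p\<in>interior_pts n. net_current n g u p = 0)"

lemma potential_iff: "potential n g b u \<longleftrightarrow> harmonic n g u \<and> (\<forall>q\<in>boundary_pts n. u q = b q)"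
  by (simp add: potential_def harmonic_def net_current_def)

lemma hor_pos: "conductivity_profile n \<gamma> \<Longrightarrow> {(i, j), (i + 1, j)} \<in> edges n \<Longrightarrow> hor n \<gamma> i j > 0"
  by (simp add: hor_def conductivity_profile_def)

lemma ver_pos: "conductivity_profile n \<gamma> \<Longrightarrow> {(i, j), (i, j - 1)} \<in> edges n \<Longrightarrow> ver n \<gamma> i j > 0"
  by (simp add: ver_def conductivity_profile_def)

lemma hor_nonneg: "conductivity_profile n \<gamma> \<Longrightarrow> hor n \<gamma> i j \<ge> 0"
  by (simp add: hor_def conductivity_profile_def less_imp_le)

lemma ver_nonneg: "conductivity_profile n \<gamma> \<Longrightarrow> ver n \<gamma> i j \<ge> 0"
  by (simp add: ver_def conductivity_profile_def less_imp_le)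

section \<open>The Dirichlet problem\<close>

text \<open>At an interior maximum all four terms of the net current are nonpositive, so the left
  neighbour is a maximum as well. Moving left leads to a boundary point.\<close>

lemma maximum_principle:
  assumes \<gamma>: "conductivity_profile n \<gamma>" and u: "harmonic n \<gamma> u"
    and bd: "\<And>q. q \<in> boundary_pts n \<Longrightarrow> u q \<le> 0" and p: "p \<in> lattice_pts n"
  shows "u p \<le> 0"
proof -
  define M where "M = Max (u ` lattice_pts n)"
  have le: "u q \<le> M" if "q \<in> lattice_pts n" for q
    using that finite_lattice[of n] by (auto simp: M_def)
  have "M \<in> u ` lattice_pts n"
    unfolding M_def using p finite_lattice[of n] by (intro Max_in) auto
  then obtain i j where ij: "(i, j) \<in> lattice_pts n" "u (i, j) = M"
    by auto
  have "M \<le> 0" if "(int k, j) \<in> lattice_pts n" "u (int k, j) = M" for k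
    using that
  proof (induction k)
    case 0
    then have "(0, j) \<in> boundary_pts n"
      by (auto simp: lattice_iff boundary_pts_def)
    with 0 bd show ?case by force
  next
    case (Suc k)
    let ?i = "int (Suc k)"
    show ?case
    proof (cases "(?i, j) \<in> boundary_pts n")
      case True
      with Suc.prems bd show ?thesis by force
    next
      case False
      then have int: "(?i, j) \<in> interior_pts n"
        using Suc.prems by (simp add: lattice_cases)
      have nb: "(?i - 1, j) \<in> lattice_pts n" "(?i + 1, j) \<in> lattice_pts n"
        "(?i, j + 1) \<in> lattice_pts n" "(?i, j - 1) \<in> lattice_pts n"
        using int by (auto simp: lattice_iff interior_iff)
      have pos: "hor n \<gamma> (?i - 1) j > 0"
        using int by (intro hor_pos[OF \<gamma>]) (auto simp: horizontal_edge_iff interior_iff)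
      have le': "g * (u q - u (?i, j)) \<le> 0" if "g \<ge> 0" "q \<in> lattice_pts n" for g q
        using that le[of q] Suc.prems by (simp add: mult_nonneg_nonpos)
      have "net_current n \<gamma> u (?i, j) = 0"
        using u int by (simp add: harmonic_def)
      then have "hor n \<gamma> (?i - 1) j * (u (?i - 1, j) - u (?i, j)) = 0"
        unfolding net_current_coord
        using le'[OF hor_nonneg[OF \<gamma>] nb(1), of "?i - 1" j] le'[OF hor_nonneg[OF \<gamma>] nb(2), of ?i j]
          le'[OF ver_nonneg[OF \<gamma>] nb(3), of ?i "j + 1"] le'[OF ver_nonneg[OF \<gamma>] nb(4), of ?i j]
        by linarith
      then have "u (?i - 1, j) = M"
        using pos Suc.prems by simp
      then show ?thesis
        using Suc.IH nb(1) by simp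
    qed
  qed
  from this[of "nat i"] have "M \<le> 0"
    using ij by (simp add: lattice_iff)
  with le[OF p] show ?thesis by simp
qed

lemma dirichlet_unique:
  assumes \<gamma>: "conductivity_profile n \<gamma>" and u: "harmonic n \<gamma> u" and v: "harmonic n \<gamma> v"
    and bd: "\<And>q. q \<in> boundary_pts n \<Longrightarrow> u q = v q" and p: "p \<in> lattice_pts n"
  shows "u p = v p"
proof -
  have "a p \<le> b p" if "harmonic n \<gamma> a" "harmonic n \<gamma> b"
    and "\<And>q. q \<in> boundary_pts n \<Longrightarrow> a q = b q" for a b
  proof -
    have "net_current n \<gamma> (\<lambda>p. a p - b p) q = net_current n \<gamma> a q - net_current n \<gamma> b q" for q
      by (simp add: net_current_def sum_subtractf algebra_simps)
    then have "harmonic n \<gamma> (\<lambda>p. a p - b p)"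
      using that by (simp add: harmonic_def)
    from maximum_principle[OF \<gamma> this _ p] show ?thesis
      using that by simp
  qed
  from this[of u v] this[of v u] show ?thesis
    using u v bd by fastforce
qed

lemma injective_system_solvable:
  fixes a :: "'i \<Rightarrow> 'i \<Rightarrow> 'k :: field"
  assumes D: "finite D"
    and inj: "\<And>x. (\<And>p. p \<in> D \<Longrightarrow> (\<Sum>q\<in>D. a p q * x q) = 0) \<Longrightarrow> (\<And>p. p \<in> D \<Longrightarrow> x p = 0)"
  obtains x where "\<And>p. p \<in> D \<Longrightarrow> (\<Sum>q\<in>D. a p q * x q) = b p"
proof -
  define N where "N = card D"
  obtain h where h: "bij_betw h {0..<N} D"
    using ex_bij_betw_nat_finite[OF D] by (auto simp: N_def)
  define A where "A = mat N N (\<lambda>(r, s). a (h r) (h s))"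
  have A: "A \<in> carrier_mat N N" by (simp add: A_def)
  define g where "g = the_inv_into {0..<N} h"
  have g: "g (h r) = r" if "r < N" for r
    using h that unfolding g_def by (intro the_inv_into_f_f) (auto simp: bij_betw_def)
  have row: "(A *\<^sub>v v) $ r = (\<Sum>q\<in>D. a (h r) q * (v $ g q))"
    if "v \<in> carrier_vec N" "r < N" for v r
  proof -
    have "(A *\<^sub>v v) $ r = (\<Sum>s = 0..<N. a (h r) (h s) * (v $ s))"
      using that by (simp add: A_def scalar_prod_def)
    also have "\<dots> = (\<Sum>s = 0..<N. a (h r) (h s) * (v $ g (h s)))"
      using g by simp
    also have "\<dots> = (\<Sum>q\<in>D. a (h r) q * (v $ g q))"
      by (rule sum.reindex_bij_betw[OF h])
    finally show ?thesis .
  qed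
  have onto: "\<exists>r<N. p = h r" if "p \<in> D" for p
    using h that by (auto simp: bij_betw_def)
  have "det A \<noteq> 0"
  proof
    assume "det A = 0"
    then obtain v where v: "v \<in> carrier_vec N" "v \<noteq> 0\<^sub>v N" "A *\<^sub>v v = 0\<^sub>v N"
      using det_0_iff_vec_prod_zero[OF A] by blast
    have "(\<Sum>q\<in>D. a p q * (v $ g q)) = 0" if "p \<in> D" for p
      using onto[OF that] row[OF v(1)] v(3) by force
    then have "v $ g p = 0" if "p \<in> D" for p
      using inj[of "\<lambda>q. v $ g q"] that by blast
    then have "v $ r = 0" if "r < N" for r
      using that g[of r] h by (metis atLeastLessThan_iff bij_betwE zero_le)
    then have "v = 0\<^sub>v N" using v(1) by (intro eq_vecI) auto
    with v(2) show False ..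
  qed
  then obtain B where B: "B \<in> carrier_mat N N" "A * B = 1\<^sub>m N"
    using det_non_zero_imp_unit[OF A, of "()"] by (auto simp: Units_def ring_mat_def)
  define v where "v = B *\<^sub>v vec N (\<lambda>r. b (h r))"
  have v: "v \<in> carrier_vec N" using B by (simp add: v_def)
  have "A *\<^sub>v v = (A * B) *\<^sub>v vec N (\<lambda>r. b (h r))"
    unfolding v_def by (rule assoc_mult_mat_vec[symmetric]) (use A B in auto)
  then have Av: "A *\<^sub>v v = vec N (\<lambda>r. b (h r))" using B by simp
  have "(\<Sum>q\<in>D. a p q * (v $ g q)) = b p" if p: "p \<in> D" for p
  proof -
    obtain r where "r < N" "p = h r" using onto[OF p] by blast
    then show ?thesis using row[OF v, of r] Av by simp
  qed
  then show ?thesis by (rule that)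
qed

text \<open>Uniqueness makes the square system for the interior values injective, hence solvable. The
  boundary values enter through their extension by zero, whose net current is moved to the right-hand side.\<close>

lemma dirichlet_exists:
  assumes \<gamma>: "conductivity_profile n \<gamma>"
  shows "\<exists>u. potential n \<gamma> b u"
proof -
  let ?D = "interior_pts n"
  define z where "z = (\<lambda>x p. if p \<in> ?D then x p else (0::real))"
  define b0 where "b0 = (\<lambda>p. if p \<in> ?D then 0 else b p)"
  define e where "e = (\<lambda>q p :: point. if p = q then 1 else (0::real))"
  define a where "a = (\<lambda>p q. net_current n \<gamma> (e q) p)"
  have fin: "finite ?D" by (simp add: interior_pts_def)
  have z: "(\<Sum>q\<in>?D. a p q * x q) = net_current n \<gamma> (z x) p" for x p
  proof -
    have "z x = (\<lambda>p. \<Sum>q\<in>?D. x q * e q p)"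
      using fin by (auto simp: z_def e_def fun_eq_iff if_distrib cong: if_cong)
    then show ?thesis
      by (simp only: net_current_lincomb) (simp add: a_def mult.commute)
  qed
  have "x p = 0" if x: "\<And>p. p \<in> ?D \<Longrightarrow> (\<Sum>q\<in>?D. a p q * x q) = 0" and p: "p \<in> ?D" for x p
  proof -
    have "harmonic n \<gamma> (z x)" using x by (simp add: harmonic_def z)
    moreover have "harmonic n \<gamma> (\<lambda>_. 0)" by (simp add: harmonic_def net_current_def)
    moreover have "z x q = 0" if "q \<in> boundary_pts n" for q
      using that disjoint_boundary_interior by (auto simp: z_def)
    ultimately have "z x p = 0"
      using dirichlet_unique[OF \<gamma>, of "z x" "\<lambda>_. 0" p] p by (simp add: lattice_cases)
    with p show ?thesis by (simp add: z_def)
  qed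
  then obtain x where x: "\<And>p. p \<in> ?D \<Longrightarrow> (\<Sum>q\<in>?D. a p q * x q) = - net_current n \<gamma> b0 p"
    using injective_system_solvable[OF fin, of a "\<lambda>p. - net_current n \<gamma> b0 p"] by blast
  have "net_current n \<gamma> (\<lambda>p. z x p + b0 p) p = net_current n \<gamma> (z x) p + net_current n \<gamma> b0 p" for p
    by (simp add: net_current_def sum.distrib[symmetric] algebra_simps)
  then have "harmonic n \<gamma> (\<lambda>p. z x p + b0 p)"
    using x by (simp add: harmonic_def z)
  moreover have "z x q + b0 q = b q" if "q \<in> boundary_pts n" for q
    using that disjoint_boundary_interior by (auto simp: z_def b0_def)
  ultimately show ?thesis
    unfolding potential_iff by blast
qed

section \<open>Harmonic functions with prescribed values on two diagonals\<close>

text \<open>Away from the diagonals \<open>c\<close> and \<open>c + 1\<close>, the value at \<open>(i, j)\<close> is obtained by solving the harmonic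
  equation at the neighbour nearer to these diagonals: at the left neighbour beyond \<open>c + 1\<close>, at the right neighbour
  before \<open>c\<close>. If that neighbour is not an interior point, no equation determines the value, and it is
  copied from \<open>f\<close>. The recursion ends since it moves from column to column, towards the left
  in the first case and towards the right in the second.\<close>

function diag_ext ::
  "nat \<Rightarrow> (point set \<Rightarrow> real) \<Rightarrow> int \<Rightarrow> (point \<Rightarrow> real) \<Rightarrow> int \<Rightarrow> int \<Rightarrow> real" where
  "diag_ext n g c f i j =
    (if i - j > c + 1 \<and> (i - 1, j) \<in> interior_pts n then
       diag_ext n g c f (i - 1) j
       - (hor n g (i - 2) j * (diag_ext n g c f (i - 2) j - diag_ext n g c f (i - 1) j)
          + ver n g (i - 1) (j + 1) * (diag_ext n g c f (i - 1) (j + 1) - diag_ext n g c f (i - 1) j)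
          + ver n g (i - 1) j * (diag_ext n g c f (i - 1) (j - 1) - diag_ext n g c f (i - 1) j))
         / hor n g (i - 1) j
     else if i - j < c \<and> (i + 1, j) \<in> interior_pts n then
       diag_ext n g c f (i + 1) j
       - (hor n g (i + 1) j * (diag_ext n g c f (i + 2) j - diag_ext n g c f (i + 1) j)
          + ver n g (i + 1) (j + 1) * (diag_ext n g c f (i + 1) (j + 1) - diag_ext n g c f (i + 1) j)
          + ver n g (i + 1) j * (diag_ext n g c f (i + 1) (j - 1) - diag_ext n g c f (i + 1) j))
         / hor n g i j
     else f (i, j))"
  by pat_completeness auto
termination
  by (relation "measure (\<lambda>(n, g, c, f, i, j).
        if i - j > c + 1 then nat i else if i - j < c then nat (int n + 1 - i) else 0)")
     (auto simp: interior_iff)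

declare diag_ext.simps [simp del]

text \<open>Each interior point provides exactly one equation: a point on or beyond diagonal \<open>c + 1\<close> fixes its right
  neighbour, and any other point fixes its left neighbour. So no two
  equations compete for the same value. The points of the top row are copied from \<open>f\<close>,
  since their horizontal neighbours are not interior, and therefore the zero on the top side survives.\<close>

lemma harmonic_with_diagonal_data:
  assumes \<gamma>: "conductivity_profile n \<gamma>" and top: "\<And>i. f (i, int n + 1) = 0"
  obtains u where "harmonic n \<gamma> u" and "\<And>i. u (i, int n + 1) = 0"
    and "\<And>i j. i - j = c \<or> i - j = c + 1 \<Longrightarrow> u (i, j) = f (i, j)"
proof
  define u where "u = (\<lambda>(i, j). diag_ext n \<gamma> c f i j)"
  show "u (i, int n + 1) = 0" for i
    using top by (simp add: u_def diag_ext.simps[of n \<gamma> c f i] interior_iff)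
  show "u (i, j) = f (i, j)" if "i - j = c \<or> i - j = c + 1" for i j
    using that by (auto simp: u_def diag_ext.simps[of n \<gamma> c f i])
  have "net_current n \<gamma> u (i, j) = 0" if p: "(i, j) \<in> interior_pts n" for i j
  proof -
    have "hor n \<gamma> i j \<noteq> 0" "hor n \<gamma> (i - 1) j \<noteq> 0"
      using p hor_pos[OF \<gamma>, of i j] hor_pos[OF \<gamma>, of "i - 1" j]
      by (auto simp: horizontal_edge_iff interior_iff)
    then show ?thesis
    proof (cases "i - j \<ge> c + 1")
      case True
      have "u (i + 1, j) = u (i, j)
          - (hor n \<gamma> (i - 1) j * (u (i - 1, j) - u (i, j))
             + ver n \<gamma> i (j + 1) * (u (i, j + 1) - u (i, j))
             + ver n \<gamma> i j * (u (i, j - 1) - u (i, j))) / hor n \<gamma> i j"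
        using True p unfolding u_def prod.case by (subst diag_ext.simps) simp
      then show ?thesis
        using \<open>hor n \<gamma> i j \<noteq> 0\<close> by (simp add: net_current_coord field_simps)
    next
      case False
      have "u (i - 1, j) = u (i, j)
          - (hor n \<gamma> i j * (u (i + 1, j) - u (i, j))
             + ver n \<gamma> i (j + 1) * (u (i, j + 1) - u (i, j))
             + ver n \<gamma> i j * (u (i, j - 1) - u (i, j))) / hor n \<gamma> (i - 1) j"
        using False p unfolding u_def prod.case by (subst diag_ext.simps) (simp add: add.commute)
      then show ?thesis
        using \<open>hor n \<gamma> (i - 1) j \<noteq> 0\<close> by (simp add: net_current_coord field_simps)
    qed
  qed
  then show "harmonic n \<gamma> u" by (auto simp: harmonic_def)
qed

section \<open>Recovering the conductivities diagonal by diagonal\<close>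

definition admissible :: "nat \<Rightarrow> (point set \<Rightarrow> real) \<Rightarrow> (point \<Rightarrow> real) \<Rightarrow> bool" where
  "admissible n \<gamma> u \<longleftrightarrow> harmonic n \<gamma> u \<and> (\<forall>i. u (i, int n + 1) = 0)"

definition matched ::
  "nat \<Rightarrow> (point set \<Rightarrow> real) \<Rightarrow> (point set \<Rightarrow> real) \<Rightarrow> (point \<Rightarrow> real) \<Rightarrow> (point \<Rightarrow> real) \<Rightarrow> bool" where
  "matched n \<gamma> w u x \<longleftrightarrow> (\<forall>q\<in>boundary_pts n. x q = u q) \<and>
     (\<forall>p\<in>lattice_pts n. net_current n w x p = net_current n \<gamma> u p)"

text \<open>The information on the edge weights \<open>w\<close> that is extracted from zero loss. As \<open>x\<close> is not known to be determined by
  \<open>u\<close> before the sweep is complete, the statements below concern all matched pairs.\<close>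

locale matched_weights =
  fixes n :: nat and \<gamma> w :: "point set \<Rightarrow> real"
  assumes pos: "conductivity_profile n \<gamma>"
    and matched_ex: "admissible n \<gamma> u \<Longrightarrow> \<exists>x. matched n \<gamma> w u x"
begin

text \<open>State of the sweep: the edges that leave a diagonal before \<open>c\<close> to the right or downwards are
  recovered, and matched pairs coincide up to diagonal \<open>c\<close>.\<close>

definition agree :: "int \<Rightarrow> bool" where
  "agree c \<longleftrightarrow>
     (\<forall>i j. i - j < c \<longrightarrow> hor n w i j = hor n \<gamma> i j \<and> ver n w i j = ver n \<gamma> i j) \<and>
     (\<forall>u x i j. admissible n \<gamma> u \<longrightarrow> matched n \<gamma> w u x \<longrightarrow> (i, j) \<in> lattice_pts n \<longrightarrow>
        i - j \<le> c \<longrightarrow> x (i, j) = u (i, j))"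

lemma delta_pair:
  assumes "b \<le> int n"
  obtains u x where "admissible n \<gamma> u" and "matched n \<gamma> w u x"
    and "\<And>i j. i - j = c \<or> i - j = c + 1 \<Longrightarrow> u (i, j) = (if (i, j) = (a, b) then 1 else 0)"
proof -
  let ?f = "\<lambda>p. if p = (a, b) then 1 else 0 :: real"
  have "?f (i, int n + 1) = 0" for i
    using assms by simp
  from harmonic_with_diagonal_data[of n \<gamma> ?f c, OF pos this]
  obtain u where u: "harmonic n \<gamma> u" "\<And>i. u (i, int n + 1) = 0"
    and d: "\<And>i j. i - j = c \<or> i - j = c + 1 \<Longrightarrow> u (i, j) = ?f (i, j)"
    by blast
  from u have adm: "admissible n \<gamma> u" by (simp add: admissible_def)
  from matched_ex[OF adm] obtain x where "matched n \<gamma> w u x" ..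
  from that[OF adm this d] show ?thesis by simp
qed

text \<open>The left and the upper edge at a point of diagonal \<open>c\<close> carry the same current on both sides and cancel.\<close>

lemma forward_current_eq:
  assumes c: "agree c" and u: "admissible n \<gamma> u" and x: "matched n \<gamma> w u x"
    and p: "(i, j) \<in> lattice_pts n" "i - j = c"
  shows "hor n w i j * (x (i + 1, j) - u (i, j)) + ver n w i j * (x (i, j - 1) - u (i, j))
       = hor n \<gamma> i j * (u (i + 1, j) - u (i, j)) + ver n \<gamma> i j * (u (i, j - 1) - u (i, j))"
proof -
  have "net_current n w x (i, j) = net_current n \<gamma> u (i, j)"
    using x p by (simp add: matched_def)
  moreover have "hor n w (i - 1) j = hor n \<gamma> (i - 1) j" "ver n w i (j + 1) = ver n \<gamma> i (j + 1)"
    using c p by (auto simp: agree_def)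
  moreover have xu: "x (a, b) = u (a, b)" if "(a, b) \<in> lattice_pts n" "a - b \<le> c" for a b
    using c u x that by (auto simp: agree_def)
  then have "x (i, j) = u (i, j)" using p by simp
  moreover have "hor n \<gamma> (i - 1) j * (x (i - 1, j) - u (i, j))
      = hor n \<gamma> (i - 1) j * (u (i - 1, j) - u (i, j))"
    using xu[of "i - 1" j] p by (auto simp: hor_def edge_iff)
  moreover have "ver n \<gamma> i (j + 1) * (x (i, j + 1) - u (i, j))
      = ver n \<gamma> i (j + 1) * (u (i, j + 1) - u (i, j))"
    using xu[of i "j + 1"] p by (auto simp: ver_def edge_iff)
  ultimately show ?thesis
    by (simp add: net_current_coord)
qed

text \<open>Induction from the top right end. On the boundary, \<open>x = u\<close>. At the upper neighbour of an interior
  point \<open>(i, j)\<close>, which lies on diagonal \<open>c\<close>, the forward equation relates \<open>x (i, j)\<close> to the value of \<open>x\<close> one step further up the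
  diagonal \<open>c + 1\<close>, which is zero by induction. What remains is \<open>ver n w i (j + 1) * x (i, j) = 0\<close>. The weight
  is nonzero: with the test function that is \<open>1\<close> at \<open>(i, j)\<close> and \<open>0\<close> elsewhere on the two diagonals, the same
  equation has the right-hand side \<open>ver n \<gamma> i (j + 1) > 0\<close>.\<close>

lemma zero_from_top_right:
  assumes c: "agree c" and u: "admissible n \<gamma> u" and x: "matched n \<gamma> w u x"
    and zero: "\<And>i' j'. i' \<ge> i \<Longrightarrow> i' - j' = c \<or> i' - j' = c + 1 \<Longrightarrow> u (i', j') = 0"
    and q: "(i, j) \<in> lattice_pts n" "i - j = c + 1"
  shows "x (i, j) = 0"
proof -
  have "i \<le> int n + 2" using q by (simp add: lattice_iff)
  then show ?thesis using u x zero q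
  proof (induction i arbitrary: u x j rule: int_le_induct)
    case base
    then show ?case by (simp add: lattice_iff)
  next
    case (step i)
    let ?i = "i - 1"
    show ?case
    proof (cases "(?i, j) \<in> boundary_pts n")
      case True
      then have "x (?i, j) = u (?i, j)"
        using step.prems(2) by (simp add: matched_def)
      with step.prems show ?thesis by simp
    next
      case False
      then have int: "(?i, j) \<in> interior_pts n"
        using step.prems by (simp add: lattice_cases)
      then have p: "(?i, j + 1) \<in> lattice_pts n" "{(?i, j + 1), (?i, j + 1 - 1)} \<in> edges n"
        by (auto simp: lattice_iff vertical_edge_iff interior_iff)
      have right: "hor n w ?i (j + 1) * y (i, j + 1) = 0"
        if "admissible n \<gamma> v" "matched n \<gamma> w v y"
          "\<And>i' j'. i' \<ge> i \<Longrightarrow> i' - j' = c \<or> i' - j' = c + 1 \<Longrightarrow> v (i', j') = 0" for v y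
      proof (cases "{(?i, j + 1), (?i + 1, j + 1)} \<in> edges n")
        case True
        then have "(i, j + 1) \<in> lattice_pts n" by (simp add: edge_iff)
        then show ?thesis using step.IH[OF that] step.prems(5) by simp
      qed (simp add: hor_def)
      have balance: "ver n w ?i (j + 1) * y (?i, j) = ver n \<gamma> ?i (j + 1) * v (?i, j)"
        if "admissible n \<gamma> v" "matched n \<gamma> w v y"
          "\<And>i' j'. i' \<ge> i \<Longrightarrow> i' - j' = c \<or> i' - j' = c + 1 \<Longrightarrow> v (i', j') = 0"
          "v (?i, j + 1) = 0" for v y
        using forward_current_eq[OF c that(1,2) p(1)] right[OF that(1-3)] that(3)[of i "j + 1"]
          that(4) step.prems(5) by simp
      obtain v y where vy: "admissible n \<gamma> v" "matched n \<gamma> w v y"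
        "\<And>i' j'. i' - j' = c \<or> i' - j' = c + 1 \<Longrightarrow> v (i', j') = (if (i', j') = (?i, j) then 1 else 0)"
        using delta_pair[of j c ?i] int by (auto simp: interior_iff)
      have "ver n w ?i (j + 1) * y (?i, j) = ver n \<gamma> ?i (j + 1)"
        using balance[OF vy(1,2)] vy(3) step.prems(5) by simp
      then have "ver n w ?i (j + 1) \<noteq> 0"
        using ver_pos[OF pos p(2)] by auto
      moreover have "ver n w ?i (j + 1) * x (?i, j) = 0"
        using balance[OF step.prems(1,2)] step.prems(3,5) by simp
      ultimately show ?thesis by simp
    qed
  qed
qed

text \<open>Induction from the bottom left end. The lower neighbour of \<open>(i, j)\<close> is a boundary point or the
  right neighbour of the previous point of the diagonal, so \<open>x = u\<close> there. The test function
  at the lower neighbour isolates the vertical weight. The one at \<open>(i, j)\<close> itself gives the sum of the two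
  weights. In both cases \<open>zero_from_top_right\<close> removes \<open>x\<close> at the right neighbour.
  With the two weights known, the equation gives \<open>x = u\<close> at the right neighbour for every pair, because the
  horizontal conductivity is positive.\<close>

lemma agree_on_diagonal:
  assumes c: "agree c" and d: "i - j = c"
  shows "hor n w i j = hor n \<gamma> i j \<and> ver n w i j = ver n \<gamma> i j \<and>
    (\<forall>u x. admissible n \<gamma> u \<longrightarrow> matched n \<gamma> w u x \<longrightarrow> {(i, j), (i + 1, j)} \<in> edges n \<longrightarrow>
       x (i + 1, j) = u (i + 1, j))"
proof (cases "i \<ge> -1")
  case True
  then show ?thesis using d
  proof (induction i arbitrary: j rule: int_ge_induct)
    case base
    then show ?case by (simp add: hor_def ver_def horizontal_edge_iff vertical_edge_iff)
  next
    case (step i)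
    let ?i = "i + 1"
    show ?case
    proof (cases "(?i, j) \<in> lattice_pts n")
      case False
      then show ?thesis by (simp add: hor_def ver_def edge_iff)
    next
      case p: True
      have down: "ver n w ?i j * (x (?i, j - 1) - u (?i, j)) = ver n w ?i j * (u (?i, j - 1) - u (?i, j))"
        if ux: "admissible n \<gamma> u" "matched n \<gamma> w u x" for u x
      proof (cases "{(?i, j), (?i, j - 1)} \<in> edges n")
        case True
        have "x (?i, j - 1) = u (?i, j - 1)"
        proof (cases "(?i, j - 1) \<in> boundary_pts n")
          case True
          with ux show ?thesis by (simp add: matched_def)
        next
          case False
          with True have "(?i, j - 1) \<in> interior_pts n"
            by (simp add: edge_iff lattice_cases)
          then have "{(i, j - 1), (?i, j - 1)} \<in> edges n"
            by (auto simp: horizontal_edge_iff interior_iff)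
          with step.IH[of "j - 1"] step.prems ux show ?thesis by simp
        qed
        then show ?thesis by simp
      qed (simp add: ver_def)
      have bal: "hor n w ?i j * (x (?i + 1, j) - u (?i, j)) + ver n w ?i j * (u (?i, j - 1) - u (?i, j))
        = hor n \<gamma> ?i j * (u (?i + 1, j) - u (?i, j)) + ver n \<gamma> ?i j * (u (?i, j - 1) - u (?i, j))"
        if ux: "admissible n \<gamma> u" "matched n \<gamma> w u x" for u x
        using forward_current_eq[OF c ux p step.prems] down[OF ux] by simp
      have right: "hor n w ?i j * x (?i + 1, j) = 0"
        if ux: "admissible n \<gamma> u" "matched n \<gamma> w u x"
          and z: "\<And>i' j'. i' \<ge> ?i + 1 \<Longrightarrow> i' - j' = c \<or> i' - j' = c + 1 \<Longrightarrow> u (i', j') = 0" for u x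
      proof (cases "{(?i, j), (?i + 1, j)} \<in> edges n")
        case True
        then have "(?i + 1, j) \<in> lattice_pts n" by (simp add: edge_iff)
        then show ?thesis using zero_from_top_right[OF c ux z] step.prems by simp
      qed (simp add: hor_def)
      have ver_eq: "ver n w ?i j = ver n \<gamma> ?i j"
      proof (cases "{(?i, j), (?i, j - 1)} \<in> edges n")
        case True
        then have "j - 1 \<le> int n" by (simp add: vertical_edge_iff)
        then obtain u x where ux: "admissible n \<gamma> u" "matched n \<gamma> w u x"
          "\<And>i' j'. i' - j' = c \<or> i' - j' = c + 1 \<Longrightarrow> u (i', j') = (if (i', j') = (?i, j - 1) then 1 else 0)"
          using delta_pair[of "j - 1" c ?i] by blast
        have "u (?i, j) = 0" "u (?i, j - 1) = 1" "u (?i + 1, j) = 0"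
          using ux(3)[of ?i j] ux(3)[of ?i "j - 1"] ux(3)[of "?i + 1" j] step.prems by auto
        moreover have "hor n w ?i j * x (?i + 1, j) = 0"
          using right[OF ux(1,2)] ux(3) by simp
        ultimately show ?thesis
          using bal[OF ux(1,2)] by (simp del: mult_eq_0_iff)
      qed (simp add: ver_def)
      have hor_eq: "hor n w ?i j = hor n \<gamma> ?i j"
      proof (cases "{(?i, j), (?i + 1, j)} \<in> edges n")
        case True
        then have "j \<le> int n" by (simp add: horizontal_edge_iff)
        then obtain u x where ux: "admissible n \<gamma> u" "matched n \<gamma> w u x"
          "\<And>i' j'. i' - j' = c \<or> i' - j' = c + 1 \<Longrightarrow> u (i', j') = (if (i', j') = (?i, j) then 1 else 0)"
          using delta_pair[of j c ?i] by blast
        have "u (?i, j) = 1" "u (?i, j - 1) = 0" "u (?i + 1, j) = 0"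
          using ux(3)[of ?i j] ux(3)[of ?i "j - 1"] ux(3)[of "?i + 1" j] step.prems by auto
        moreover have "hor n w ?i j * x (?i + 1, j) = 0"
          using right[OF ux(1,2)] ux(3) by simp
        ultimately show ?thesis
          using bal[OF ux(1,2)] ver_eq by (simp add: right_diff_distrib del: mult_eq_0_iff)
      qed (simp add: hor_def)
      have "x (?i + 1, j) = u (?i + 1, j)"
        if "admissible n \<gamma> u" "matched n \<gamma> w u x" "{(?i, j), (?i + 1, j)} \<in> edges n" for u x
        using bal[OF that(1,2)] ver_eq hor_eq hor_pos[OF pos that(3)] by simp
      with ver_eq hor_eq show ?thesis by blast
    qed
  qed
next
  case False
  then show ?thesis by (simp add: hor_def ver_def horizontal_edge_iff vertical_edge_iff)
qed

lemma agree_step: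
  assumes c: "agree c"
  shows "agree (c + 1)"
  unfolding agree_def
proof (intro conjI allI impI)
  fix i j :: int assume "i - j < c + 1"
  then have "i - j < c \<or> i - j = c" by linarith
  then show "hor n w i j = hor n \<gamma> i j" "ver n w i j = ver n \<gamma> i j"
    using c agree_on_diagonal[OF c] unfolding agree_def by blast+
next
  fix u x and i j :: int
  assume ux: "admissible n \<gamma> u" "matched n \<gamma> w u x" and p: "(i, j) \<in> lattice_pts n" "i - j \<le> c + 1"
  show "x (i, j) = u (i, j)"
  proof (cases "i - j \<le> c \<or> (i, j) \<in> boundary_pts n")
    case True
    then show ?thesis using c ux p by (auto simp: agree_def matched_def)
  next
    case False
    then have "(i, j) \<in> interior_pts n" "i - 1 - j = c"
      using p by (auto simp: lattice_cases)
    moreover from this have "{(i - 1, j), (i - 1 + 1, j)} \<in> edges n"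
      by (auto simp: horizontal_edge_iff interior_iff)
    ultimately show ?thesis
      using agree_on_diagonal[OF c, of "i - 1" j] ux by simp
  qed
qed

theorem weights_eq:
  assumes "e \<in> edges n"
  shows "w e = \<gamma> e"
proof -
  \<comment> \<open>The first lattice points, \<open>(0, n)\<close> and \<open>(1, n + 1)\<close>, lie on the diagonal \<open>- n\<close>, so the sweep starts
    vacuously one diagonal earlier.\<close>
  have "agree c" if "c \<ge> - int n - 1" for c
    using that
  proof (induction c rule: int_ge_induct)
    case base
    show ?case
      by (auto simp: agree_def hor_def ver_def horizontal_edge_iff vertical_edge_iff lattice_iff)
  qed (rule agree_step)
  then have ag: "agree (max (- int n - 1) (i - j + 1))" for i j
    by simp
  have "hor n w i j = hor n \<gamma> i j \<and> ver n w i j = ver n \<gamma> i j" for i j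
    using ag[of i j] unfolding agree_def by (auto simp: less_max_iff_disj)
  then show ?thesis
    using weights_eq_if_hor_ver_eq assms by blast
qed

end

section \<open>From training data to arbitrary boundary data\<close>

text \<open>The first \<open>n\<close> coordinates belong to the top side, so the vector of \<open>b\<close> lies in the subspace spanned by
  the data. Showing that the linear combinations of the data form a submodule avoids computing with
  the abstract sums of the module.\<close>

lemma top_boundary_zero_in_data_span:
  assumes S: "S \<subseteq> (\<lambda>k. bdry_vec n (ub k)) ` K" "is_basis_of_last_coords n S" and K: "finite K"
    and top: "\<And>i. b (i, int n + 1) = 0"
  shows "\<exists>c. \<forall>q\<in>boundary_pts n. b q = (\<Sum>k\<in>K. c k * ub k q)"
proof -
  let ?V = "(module_vec TYPE(real) (4 * n))\<lparr>carrier := last_coords n\<rparr>"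
  interpret V: vectorspace class_ring ?V by (rule vectorspace_last_coords)
  define T where "T = {v \<in> last_coords n. \<exists>c. v = bdry_vec n (\<lambda>q. \<Sum>k\<in>K. c k * ub k q)}"
  have "S \<subseteq> T"
  proof
    fix v assume v: "v \<in> S"
    then have "v \<in> last_coords n"
      using S(2) by (auto simp: is_basis_of_last_coords_def V.basis_def)
    moreover obtain k where k: "k \<in> K" "v = bdry_vec n (ub k)" using S(1) v by blast
    have "(\<Sum>l\<in>K. (if l = k then 1 else 0) * ub l q) = ub k q" for q
      using k K by (simp add: if_distrib[of "\<lambda>x. x * _"] cong: if_cong)
    then have "v = bdry_vec n (\<lambda>q. \<Sum>l\<in>K. (if l = k then 1 else 0) * ub l q)"
      using k by simp
    ultimately show "v \<in> T"
      unfolding T_def by (intro CollectI conjI exI[of _ "\<lambda>l. if l = k then 1 else 0"])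
  qed
  moreover have "submodule class_ring T ?V"
  proof
    show "T \<subseteq> carrier ?V" by (auto simp: T_def)
    show "\<zero>\<^bsub>?V\<^esub> \<in> T"
      by (auto simp: T_def module_vec_simps last_coords_def bdry_vec_def intro!: exI[of _ "\<lambda>_. 0"])
    show "v \<oplus>\<^bsub>?V\<^esub> v' \<in> T" if vT: "v \<in> T" "v' \<in> T" for v v'
    proof -
      from vT obtain c c' where "v = bdry_vec n (\<lambda>q. \<Sum>k\<in>K. c k * ub k q)"
        "v' = bdry_vec n (\<lambda>q. \<Sum>k\<in>K. c' k * ub k q)" by (auto simp: T_def)
      then have "v + v' = bdry_vec n (\<lambda>q. \<Sum>k\<in>K. (c k + c' k) * ub k q)"
        by (auto simp: bdry_vec_def sum.distrib distrib_right)
      moreover have "v + v' \<in> last_coords n"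
        using vT by (auto simp: T_def last_coords_def)
      ultimately have "v + v' \<in> T"
        unfolding T_def by (intro CollectI conjI exI[of _ "\<lambda>k. c k + c' k"])
      then show ?thesis by (simp add: module_vec_simps)
    qed
    show "a \<odot>\<^bsub>?V\<^esub> v \<in> T" if vT: "v \<in> T" for a v
    proof -
      from vT obtain c where "v = bdry_vec n (\<lambda>q. \<Sum>k\<in>K. c k * ub k q)" by (auto simp: T_def)
      then have "a \<cdot>\<^sub>v v = bdry_vec n (\<lambda>q. \<Sum>k\<in>K. (a * c k) * ub k q)"
        by (auto simp: bdry_vec_def sum_distrib_left mult.assoc)
      moreover have "a \<cdot>\<^sub>v v \<in> last_coords n"
        using vT by (auto simp: T_def last_coords_def)
      ultimately have "a \<cdot>\<^sub>v v \<in> T"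
        unfolding T_def by (intro CollectI conjI exI[of _ "\<lambda>k. a * c k"])
      then show ?thesis by (simp add: module_vec_simps)
    qed
  qed
  ultimately have "V.span S \<subseteq> T" by (intro V.span_is_subset)
  moreover have "V.span S = last_coords n"
    using S(2) by (simp add: is_basis_of_last_coords_def V.basis_def)
  moreover have "bdry_vec n b \<in> last_coords n"
    using top by (simp add: last_coords_def bdry_vec_def bdry_pt_def)
  ultimately obtain c where c: "bdry_vec n b = bdry_vec n (\<lambda>q. \<Sum>k\<in>K. c k * ub k q)"
    by (auto simp: T_def)
  have "b q = (\<Sum>k\<in>K. c k * ub k q)" if "q \<in> boundary_pts n" for q
  proof -
    obtain l where l: "l \<in> {1..4 * n}" "q = bdry_pt n l"
      using bij_betw_imp_surj_on[OF bdry_pt_bij[of n]] \<open>q \<in> boundary_pts n\<close> by blast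
    then have "bdry_vec n b $ (l - 1) = b q"
      "bdry_vec n (\<lambda>q. \<Sum>k\<in>K. c k * ub k q) $ (l - 1) = (\<Sum>k\<in>K. c k * ub k q)"
      by (auto simp: bdry_vec_def)
    with c show ?thesis by simp
  qed
  then show ?thesis by blast
qed

section \<open>The loss\<close>

lemma loss_nonneg: "\<alpha> > 0 \<Longrightarrow> loss n \<alpha> m xt xh W \<ge> 0"
  unfolding loss_def by (intro mult_nonneg_nonneg sum_nonneg add_nonneg_nonneg) auto

lemma loss_eq_0_iff:
  assumes "\<alpha> > 0" and "m > 0"
  shows "loss n \<alpha> m xt xh W = 0 \<longleftrightarrow>
    (\<forall>k\<in>{1..m}. \<forall>p\<in>lattice_pts n. net_output n W (xt k) (xh k) p = 0)"
proof -
  have fin: "finite (boundary_pts n)" "finite (interior_pts n)"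
    by (simp_all add: boundary_pts_def interior_pts_def)
  define y where "y = (\<lambda>k p. net_output n W (xt k) (xh k) p)"
  have "loss n \<alpha> m xt xh W = 0 \<longleftrightarrow> (\<Sum>k = 1..m. (\<Sum>p\<in>boundary_pts n. (y k p)\<^sup>2)
      + \<alpha> * (\<Sum>p\<in>interior_pts n. (y k p)\<^sup>2)) = 0"
    using assms by (simp add: loss_def y_def)
  also have "\<dots> \<longleftrightarrow> (\<forall>k\<in>{1..m}. (\<Sum>p\<in>boundary_pts n. (y k p)\<^sup>2)
      + \<alpha> * (\<Sum>p\<in>interior_pts n. (y k p)\<^sup>2) = 0)"
    using assms by (intro sum_nonneg_eq_0_iff add_nonneg_nonneg mult_nonneg_nonneg sum_nonneg) auto
  also have "\<dots> \<longleftrightarrow> (\<forall>k\<in>{1..m}. \<forall>p\<in>lattice_pts n. y k p = 0)"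
    using assms fin
    by (subst add_nonneg_eq_0_iff)
       (auto simp: sum_nonneg sum_nonneg_eq_0_iff lattice_cases)
  finally show ?thesis by (simp only: y_def)
qed

lemma net_output_net_current:
  assumes "r \<in> lattice_pts n"
  shows "net_output n W xt xh r =
    (if r \<in> interior_pts n then net_current n (snd W) (hidden n W xt) r
     else - net_current n (snd W) (hidden n W xt) r - xh r)"
proof (cases "r \<in> interior_pts n")
  case True
  then show ?thesis by (simp add: net_output_def net_current_def)
next
  case False
  with assms have "r \<in> boundary_pts n" by (simp add: lattice_cases)
  with False show ?thesis by (simp add: net_output_def net_current_boundary algebra_simps)
qed

lemma cauchy_pair_net_current:
  "cauchy_pair n \<gamma> ub vb \<longleftrightarrow>
     (\<exists>u. potential n \<gamma> ub u \<and> (\<forall>q\<in>boundary_pts n. vb q = - net_current n \<gamma> u q))"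
  unfolding cauchy_pair_def
  by (intro ex_cong1 conj_cong ball_cong refl)
     (simp add: net_current_boundary insert_commute algebra_simps)

lemma zero_loss_exists:
  assumes \<gamma>: "conductivity_profile n \<gamma>" and \<alpha>: "\<alpha> > 0" and m: "m > 0"
    and data: "\<And>k. k \<in> {1..m} \<Longrightarrow> cauchy_pair n \<gamma> (ub k) (vb k)"
  shows "\<exists>W. loss n \<alpha> m ub vb W = 0"
proof -
  have fin: "finite (boundary_pts n)" by (simp add: boundary_pts_def)
  define G where "G = (\<lambda>q. SOME u. potential n \<gamma> (\<lambda>p. if p = q then 1 else 0) u)"
  have G: "potential n \<gamma> (\<lambda>p. if p = q then 1 else 0) (G q)" for q
    unfolding G_def by (rule someI_ex[OF dirichlet_exists[OF \<gamma>]])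
  let ?W = "(G, \<gamma>)"
  have "net_output n ?W (ub k) (vb k) p = 0" if k: "k \<in> {1..m}" and p: "p \<in> lattice_pts n" for k p
  proof -
    obtain u where u: "potential n \<gamma> (ub k) u" "\<And>q. q \<in> boundary_pts n \<Longrightarrow> vb k q = - net_current n \<gamma> u q"
      using data[OF k] by (auto simp: cauchy_pair_net_current)
    \<comment> \<open>The hidden layer is the superposition of the solutions for unit boundary data, which
      is the true potential by uniqueness.\<close>
    define s where "s = (\<lambda>p. \<Sum>q\<in>boundary_pts n. ub k q * G q p)"
    have s_bd: "s q = ub k q" if "q \<in> boundary_pts n" for q
    proof -
      have "s q = (\<Sum>r\<in>boundary_pts n. ub k r * (if q = r then 1 else 0))"
        unfolding s_def using G that by (intro sum.cong) (auto simp: potential_iff)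
      then show ?thesis using that fin by (simp add: if_distrib cong: if_cong)
    qed
    have "harmonic n \<gamma> s"
      using G by (simp add: harmonic_def potential_iff s_def net_current_lincomb)
    then have su: "s q = u q" if "q \<in> lattice_pts n" for q
      by (rule dirichlet_unique[OF \<gamma>]) (use u that s_bd in \<open>auto simp: potential_iff\<close>)
    have hid: "hidden n ?W (ub k) q = u q" if "q \<in> lattice_pts n" for q
      using su[OF that] s_bd[of q] by (auto simp: hidden_def s_def mult.commute)
    have "net_current n \<gamma> (hidden n ?W (ub k)) p = net_current n \<gamma> u p"
      unfolding net_current_def using hid p nbrs_subset[of n p] by (intro sum.cong) auto
    then show ?thesis
      using p u
      by (cases "p \<in> interior_pts n")
         (simp_all add: net_output_net_current potential_iff harmonic_def lattice_cases)
  qed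
  then have "loss n \<alpha> m ub vb ?W = 0" using loss_eq_0_iff[OF \<alpha> m] by blast
  then show ?thesis ..
qed

text \<open>The boundary values of \<open>u\<close> are a combination of the data. The same combination of the hidden layers is
  the required \<open>x\<close>; the same combination of the true potentials is \<open>u\<close> itself, by uniqueness.\<close>

lemma zero_loss_imp_matched:
  fixes m :: nat
  assumes \<gamma>: "conductivity_profile n \<gamma>"
    and data: "\<And>k. k \<in> {1..m} \<Longrightarrow> cauchy_pair n \<gamma> (ub k) (vb k)"
    and S: "S \<subseteq> (\<lambda>k. bdry_vec n (ub k)) ` {1..m}" "is_basis_of_last_coords n S"
    and zero: "\<And>k p. k \<in> {1..m} \<Longrightarrow> p \<in> lattice_pts n \<Longrightarrow> net_output n W (ub k) (vb k) p = 0"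
    and u: "admissible n \<gamma> u"
  shows "\<exists>x. matched n \<gamma> (snd W) u x"
proof -
  let ?h = "\<lambda>k. hidden n W (ub k)"
  obtain c where c: "\<And>q. q \<in> boundary_pts n \<Longrightarrow> u q = (\<Sum>k = 1..m. c k * ub k q)"
    using top_boundary_zero_in_data_span[OF S finite_atLeastAtMost, of u] u
    unfolding admissible_def by blast
  have "\<forall>k\<in>{1..m}. \<exists>v. potential n \<gamma> (ub k) v \<and>
      (\<forall>q\<in>boundary_pts n. vb k q = - net_current n \<gamma> v q)"
    using data unfolding cauchy_pair_net_current by blast
  from bchoice[OF this]
  obtain U where U: "\<And>k. k \<in> {1..m} \<Longrightarrow> potential n \<gamma> (ub k) (U k)"
    "\<And>k q. k \<in> {1..m} \<Longrightarrow> q \<in> boundary_pts n \<Longrightarrow> vb k q = - net_current n \<gamma> (U k) q"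
    by blast
  define s where "s = (\<lambda>p. \<Sum>k = 1..m. c k * U k p)"
  have "harmonic n \<gamma> s"
    using U(1) by (simp add: harmonic_def potential_iff s_def net_current_lincomb)
  moreover have "harmonic n \<gamma> u"
    using u by (simp add: admissible_def)
  moreover have "s q = u q" if "q \<in> boundary_pts n" for q
    using U(1) that by (simp add: c s_def potential_iff)
  ultimately have su: "s p = u p" if "p \<in> lattice_pts n" for p
    using that by (rule dirichlet_unique[OF \<gamma>])
  have cur: "net_current n (snd W) (?h k) p = net_current n \<gamma> (U k) p"
    if "k \<in> {1..m}" "p \<in> lattice_pts n" for k p
    using zero[OF that] U that
    by (cases "p \<in> interior_pts n")
       (simp_all add: net_output_net_current potential_iff harmonic_def lattice_cases)
  have "matched n \<gamma> (snd W) u (\<lambda>p. \<Sum>k = 1..m. c k * ?h k p)"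
    unfolding matched_def
  proof (intro conjI ballI)
    show "(\<Sum>k = 1..m. c k * ?h k q) = u q" if "q \<in> boundary_pts n" for q
      using that by (simp add: c hidden_def)
    fix p assume p: "p \<in> lattice_pts n"
    have "net_current n (snd W) (\<lambda>p. \<Sum>k = 1..m. c k * ?h k p) p = net_current n \<gamma> s p"
      using cur p by (simp add: net_current_lincomb s_def)
    also have "\<dots> = net_current n \<gamma> u p"
      unfolding net_current_def using su p nbrs_subset[of n p] by (intro sum.cong) auto
    finally show "net_current n (snd W) (\<lambda>p. \<Sum>k = 1..m. c k * ?h k p) p = net_current n \<gamma> u p" .
  qed
  then show ?thesis by blast
qed

lemma coeff_matrix_of_weights:
  assumes w: "\<And>e. e \<in> edges n \<Longrightarrow> snd W e = \<gamma> e"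
    and "r \<in> lattice_pts n" "p \<in> lattice_pts n"
  shows "({p, r} \<in> edges n \<and> r \<in> interior_pts n \<longrightarrow> coeff_matrix n W r p = \<gamma> {p, r}) \<and>
        ({p, r} \<in> edges n \<and> r \<in> boundary_pts n \<longrightarrow> coeff_matrix n W r p = - \<gamma> {p, r}) \<and>
        ({p, r} \<notin> edges n \<and> p \<noteq> r \<longrightarrow> coeff_matrix n W r p = 0) \<and>
        (p = r \<and> r \<in> interior_pts n \<longrightarrow>
          coeff_matrix n W r p = - (\<Sum>q\<in>nbrs n r. \<gamma> {q, r})) \<and>
        (p = r \<and> r \<in> boundary_pts n \<longrightarrow>
          (\<forall>q. nbrs n r = {q} \<longrightarrow> coeff_matrix n W r p = \<gamma> {q, r}))"
proof -
  have nb: "snd W {q, r} = \<gamma> {q, r}" if "q \<in> nbrs n r" for q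
    using that w by (simp add: nbrs_def insert_commute)
  have self: "{r} \<notin> edges n" using edge_iff[of r r n] by simp
  have "r \<in> boundary_pts n \<Longrightarrow> r \<notin> interior_pts n" using disjoint_boundary_interior by blast
  then show ?thesis
    using w nb self by (auto simp: coeff_matrix_def inner_nbr_def)
qed

theorem theorem4p1:
  fixes n m :: nat and \<alpha> :: real and \<gamma> :: "point set \<Rightarrow> real"
    and ub vb :: "nat \<Rightarrow> point \<Rightarrow> real"
  assumes "n \<ge> 1" and "\<alpha> > 0" and "conductivity_profile n \<gamma>" and "m \<ge> 3 * n"
    and "\<And>k. k \<in> {1..m} \<Longrightarrow> cauchy_pair n \<gamma> (ub k) (vb k)"
    and "\<exists>S \<subseteq> (\<lambda>k. bdry_vec n (ub k)) ` {1..m}. is_basis_of_last_coords n S"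
  shows "(\<exists>W. global_minimizer (loss n \<alpha> m ub vb) W \<and> loss n \<alpha> m ub vb W = 0) \<and>
    (\<forall>W. loss n \<alpha> m ub vb W = 0 \<longrightarrow>
      (\<forall>r\<in>lattice_pts n. \<forall>p\<in>lattice_pts n.
        ({p, r} \<in> edges n \<and> r \<in> interior_pts n \<longrightarrow> coeff_matrix n W r p = \<gamma> {p, r}) \<and>
        ({p, r} \<in> edges n \<and> r \<in> boundary_pts n \<longrightarrow> coeff_matrix n W r p = - \<gamma> {p, r}) \<and>
        ({p, r} \<notin> edges n \<and> p \<noteq> r \<longrightarrow> coeff_matrix n W r p = 0) \<and>
        (p = r \<and> r \<in> interior_pts n \<longrightarrow>
          coeff_matrix n W r p = - (\<Sum>q\<in>nbrs n r. \<gamma> {q, r})) \<and>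
        (p = r \<and> r \<in> boundary_pts n \<longrightarrow>
          (\<forall>q. nbrs n r = {q} \<longrightarrow> coeff_matrix n W r p = \<gamma> {q, r}))) \<and>
      (\<forall>e\<in>edges n. snd W e = \<gamma> e))"
proof (intro conjI allI impI)
  have m: "m > 0" using assms(1,4) by simp
  obtain W where "loss n \<alpha> m ub vb W = 0"
    using zero_loss_exists[where ub = ub and vb = vb, OF assms(3,2) m assms(5)] by blast
  then show "\<exists>W. global_minimizer (loss n \<alpha> m ub vb) W \<and> loss n \<alpha> m ub vb W = 0"
    using loss_nonneg[OF assms(2)] unfolding global_minimizer_def by metis
  fix W assume W: "loss n \<alpha> m ub vb W = 0"
  obtain S where S: "S \<subseteq> (\<lambda>k. bdry_vec n (ub k)) ` {1..m}" "is_basis_of_last_coords n S"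
    using assms(6) by blast
  interpret matched_weights n \<gamma> "snd W"
  proof
    fix u assume "admissible n \<gamma> u"
    then show "\<exists>x. matched n \<gamma> (snd W) u x"
      using zero_loss_imp_matched[where ub = ub and vb = vb, OF assms(3,5) S] W
        loss_eq_0_iff[OF assms(2) m] by blast
  qed (rule assms(3))
  show "\<forall>e\<in>edges n. snd W e = \<gamma> e" using weights_eq by blast
  show "\<forall>r\<in>lattice_pts n. \<forall>p\<in>lattice_pts n.
        ({p, r} \<in> edges n \<and> r \<in> interior_pts n \<longrightarrow> coeff_matrix n W r p = \<gamma> {p, r}) \<and>
        ({p, r} \<in> edges n \<and> r \<in> boundary_pts n \<longrightarrow> coeff_matrix n W r p = - \<gamma> {p, r}) \<and>
        ({p, r} \<notin> edges n \<and> p \<noteq> r \<longrightarrow> coeff_matrix n W r p = 0) \<and>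
        (p = r \<and> r \<in> interior_pts n \<longrightarrow>
          coeff_matrix n W r p = - (\<Sum>q\<in>nbrs n r. \<gamma> {q, r})) \<and>
        (p = r \<and> r \<in> boundary_pts n \<longrightarrow>
          (\<forall>q. nbrs n r = {q} \<longrightarrow> coeff_matrix n W r p = \<gamma> {q, r}))"
    using coeff_matrix_of_weights[OF weights_eq] by blast
qed

end
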